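(* Let $q$ be a prime power and $m,n$ positive integers. Any vector $\mathbf{x}\in \mathrm{GF}(q^m)^n$ with rank $r$ belongs to a unique elementary linear subspace $\mathcal{V}\in E_r(q^m,n)$.
   Context: The rank of $\mathbf{x}\in\mathrm{GF}(q^m)^n$ is the maximum number of coordinates of $\mathbf{x}$ that are linearly independent over $\mathrm{GF}(q)$. A $\mathrm{GF}(q^m)$-linear subspace $\mathcal{V}\subseteq \mathrm{GF}(q^m)^n$ is an elementary linear subspace (ELS) if it has a basis consisting of vectors in $\mathrm{GF}(q)^n$. $E_v(q^m,n)$ denotes the set of all ELS's of $\mathrm{GF}(q^m)^n$ with dimension $v$ (over $\mathrm{GF}(q^m)$). *)

theory Defs
  imports "HOL-Analysis.Analysis" "HOL-Number_Theory.Prime_Powers"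
begin

definition is_subfield :: "'a::field set \<Rightarrow> bool" where
  "is_subfield K \<longleftrightarrow>
     0 \<in> K \<and> 1 \<in> K \<and>
     (\<forall>a\<in>K. \<forall>b\<in>K. a + b \<in> K \<and> a * b \<in> K) \<and>
     (\<forall>a\<in>K. - a \<in> K \<and> inverse a \<in> K)"

(* Independence over K of the family of coordinates (x $ i) with i in I. It is stated
   for the family and not for the set of its values, so a repeated coordinate
   makes the family dependent. *)
definition coords_independent :: "'a::field set \<Rightarrow> 'a ^ 'n \<Rightarrow> 'n set \<Rightarrow> bool" where
  "coords_independent K x I \<longleftrightarrow>
     (\<forall>c. (\<forall>i\<in>I. c i \<in> K) \<and> (\<Sum>i\<in>I. c i * x $ i) = 0 \<longrightarrow> (\<forall>i\<in>I. c i = 0))"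

definition rank_over :: "'a::field set \<Rightarrow> 'a ^ 'n \<Rightarrow> nat" where
  "rank_over K x = Max {card I | I. coords_independent K x I}"

lemma rank_over_attained: "\<exists>I. coords_independent K x I \<and> card I = rank_over K x"
proof -
  have "finite {card I | I. coords_independent K x I}"
    by simp
  moreover have "coords_independent K x {}"
    by (simp add: coords_independent_def)
  ultimately have "rank_over K x \<in> {card I | I. coords_independent K x I}"
    unfolding rank_over_def by (intro Max_in) blast+
  then show ?thesis by auto
qed

(* Subspace, independence, span and dimension (the vec. constants) are over the full
   field 'a; only the entries of the basis vectors are restricted to K. *)
definition elementary_linear_subspace :: "'a::field set \<Rightarrow> ('a ^ 'n) set \<Rightarrow> bool" where
  "elementary_linear_subspace K V \<longleftrightarrow>
     vec.subspace V \<and>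
     (\<exists>B. B \<subseteq> {b. \<forall>i. b $ i \<in> K} \<and> vec.independent B \<and> vec.span B = V)"

definition ELS :: "'a::field set \<Rightarrow> nat \<Rightarrow> ('a ^ 'n) set set" where
  "ELS K v = {V. elementary_linear_subspace K V \<and> vec.dim V = v}"

end

theory Submission
  imports Defs
begin

text \<open>Let \<open>I\<close> index a maximal independent family of coordinates of \<open>x\<close>. For \<open>i \<in> I\<close> extend the
  coefficient map of \<open>x\<^sub>i\<close> to a \<open>K\<close>-linear functional on the whole field and apply
  it to every coordinate of \<open>x\<close>. The resulting vectors \<open>b\<^sub>i\<close> have entries in \<open>K\<close>, restrict to the
  identity matrix on \<open>I\<close>, and satisfy \<open>x = \<Sum> x\<^sub>i b\<^sub>i\<close>. Conversely, an elementary linear subspace is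
  stable under coordinatewise application of \<open>K\<close>-linear maps, so if it contains \<open>x\<close> it
  contains every \<open>b\<^sub>i\<close>; comparing dimensions gives uniqueness.\<close>

lemma coords_independentD:
  assumes "coords_independent K x I" "\<And>i. i \<in> I \<Longrightarrow> c i \<in> K" "(\<Sum>i\<in>I. c i * x $ i) = 0" "i \<in> I"
  shows "c i = 0"
  using assms unfolding coords_independent_def by blast

lemma is_subfield_diff: "is_subfield K \<Longrightarrow> a \<in> K \<Longrightarrow> b \<in> K \<Longrightarrow> a - b \<in> K"
  unfolding is_subfield_def by (metis diff_conv_add_uminus)

text \<open>The difference of two coefficient families stays in \<open>K\<close>, so independence
  kills it. This makes coefficients well defined as functions of the represented element.\<close>

lemma coords_independent_coeffs_unique:
  assumes "is_subfield K" "coords_independent K x I"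
    and "\<And>i. i \<in> I \<Longrightarrow> c i \<in> K" "\<And>i. i \<in> I \<Longrightarrow> d i \<in> K"
    and "(\<Sum>i\<in>I. c i * x $ i) = (\<Sum>i\<in>I. d i * x $ i)" "i \<in> I"
  shows "c i = d i"
proof -
  have "(\<Sum>i\<in>I. (c i - d i) * x $ i) = 0"
    using assms(5) by (simp add: left_diff_distrib sum_subtractf)
  then have "c i - d i = 0"
    using coords_independentD[OF assms(2), of "\<lambda>i. c i - d i" i] assms(1,3,4,6) is_subfield_diff by blast
  then show ?thesis by simp
qed

text \<open>Adjoining a new index \<open>j\<close> creates a relation over \<open>K\<close>, which
  can be solved for \<open>x $ j\<close>.\<close>

lemma maximal_coords_independent_spans:
  fixes x :: "'a::field ^ 'n"
  assumes K: "is_subfield K" and I: "coords_independent K x I"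
    and max: "\<And>j. j \<notin> I \<Longrightarrow> \<not> coords_independent K x (insert j I)"
  shows "\<exists>c. (\<forall>i. c i \<in> K) \<and> x $ j = (\<Sum>i\<in>I. c i * x $ i)"
proof (cases "j \<in> I")
  case True
  have "(\<Sum>i\<in>I. (if i = j then 1 else 0) * x $ i) = (\<Sum>i\<in>I. if i = j then x $ i else 0)"
    by (intro sum.cong) auto
  then show ?thesis
    using K True by (intro exI[of _ "\<lambda>i. if i = j then 1 else 0"]) (auto simp: is_subfield_def)
next
  case False
  obtain c k where c: "\<And>i. i \<in> insert j I \<Longrightarrow> c i \<in> K"
    and s: "(\<Sum>i\<in>insert j I. c i * x $ i) = 0" and k: "k \<in> insert j I" "c k \<noteq> 0"
    using max[OF False] unfolding coords_independent_def by blast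
  have s': "c j * x $ j + (\<Sum>i\<in>I. c i * x $ i) = 0" using s False by simp
  \<comment> \<open>Otherwise the relation would live on \<open>I\<close> alone, and independence
    would contradict \<open>c k \<noteq> 0\<close>.\<close>
  have cj: "c j \<noteq> 0"
    using coords_independentD[OF I, of c k] c s' k by auto
  \<comment> \<open>Nothing is known about \<open>c\<close> outside \<open>insert j I\<close>; the
    default 0 keeps every \<open>d i\<close> in \<open>K\<close>.\<close>
  define d where "d i = (if i \<in> I then - (inverse (c j) * c i) else 0)" for i
  have "d i \<in> K" for i
    using K c unfolding d_def is_subfield_def by auto
  moreover have "(\<Sum>i\<in>I. d i * x $ i) = - inverse (c j) * (\<Sum>i\<in>I. c i * x $ i)"
    unfolding sum_distrib_left by (intro sum.cong) (auto simp: d_def)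
  moreover have "\<dots> = x $ j"
  proof -
    have "(\<Sum>i\<in>I. c i * x $ i) = - (c j * x $ j)" using s' by (simp add: add_eq_0_iff)
    then show ?thesis using cj by simp
  qed
  ultimately show ?thesis by metis
qed

lemma coords_independent_extend_maximal:
  fixes x :: "'a::field ^ 'n"
  assumes "coords_independent K x I"
  obtains S where "I \<subseteq> S" "coords_independent K x S"
    "\<And>j. j \<notin> S \<Longrightarrow> \<not> coords_independent K x (insert j S)"
proof -
  let ?F = "{S. I \<subseteq> S \<and> coords_independent K x S}"
  have "finite ?F" "I \<in> ?F" using assms by auto
  from finite_has_maximal2[OF this] obtain S where "S \<in> ?F"
    and max: "\<forall>T\<in>?F. S \<subseteq> T \<longrightarrow> S = T" by auto
  then have S: "I \<subseteq> S" "coords_independent K x S" by auto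
  have "\<not> coords_independent K x (insert j S)" if "j \<notin> S" for j
    using max S(1) that by blast
  with S show ?thesis by (rule that)
qed

definition linear_over :: "'a::field set \<Rightarrow> ('a \<Rightarrow> 'a) \<Rightarrow> bool" where
  "linear_over K f \<longleftrightarrow> (\<forall>a b. f (a + b) = f a + f b) \<and> (\<forall>c\<in>K. \<forall>a. f (c * a) = c * f a)"

lemma linear_over_sum:
  assumes "linear_over K f"
  shows "f (\<Sum>i\<in>A. g i) = (\<Sum>i\<in>A. f (g i))"
proof -
  have "f 0 + f 0 = f 0" using assms unfolding linear_over_def by (metis add_0)
  then have "f 0 = 0" by (simp only: add_cancel_left_left)
  with assms show ?thesis
    by (induction A rule: infinite_finite_induct) (auto simp: linear_over_def)
qed

text \<open>The functional is the coordinate at \<open>x $ i\<close> in a \<open>K\<close>-basis of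
  the field that extends the coordinates indexed by \<open>I\<close>.\<close>

lemma dual_functional_exists:
  fixes x :: "'a::{field,finite} ^ 'n"
  assumes K: "is_subfield K" and I: "coords_independent K x I" and i: "i \<in> I"
  shows "\<exists>f. linear_over K f \<and> range f \<subseteq> K \<and> (\<forall>k\<in>I. f (x $ k) = (if k = i then 1 else 0))"
proof -
  \<comment> \<open>All field elements are appended to the coordinates of \<open>x\<close>, so that a maximal independent
    family spans the field.\<close>
  define y :: "'a ^ ('n + 'a)" where "y = (\<chi> k. case k of Inl j \<Rightarrow> x $ j | Inr a \<Rightarrow> a)"
  have "coords_independent K y (Inl ` I)"
    unfolding coords_independent_def
  proof (intro allI impI)
    fix c assume *: "(\<forall>k\<in>Inl ` I. c k \<in> K) \<and> (\<Sum>k\<in>Inl ` I. c k * y $ k) = 0"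
    then have "(\<Sum>j\<in>I. c (Inl j) * x $ j) = 0"
      by (simp add: sum.reindex y_def)
    then show "\<forall>k\<in>Inl ` I. c k = 0"
      using coords_independentD[OF I, of "\<lambda>j. c (Inl j)"] * by blast
  qed
  then obtain S where S: "Inl ` I \<subseteq> S" "coords_independent K y S"
    "\<And>j. j \<notin> S \<Longrightarrow> \<not> coords_independent K y (insert j S)"
    using coords_independent_extend_maximal by blast
  have "\<exists>c. (\<forall>k. c k \<in> K) \<and> a = (\<Sum>k\<in>S. c k * y $ k)" for a
    using maximal_coords_independent_spans[OF K S(2,3), of "Inr a"] by (simp add: y_def)
  then obtain C where CK: "\<And>a k. C a k \<in> K" and C: "\<And>a. (\<Sum>k\<in>S. C a k * y $ k) = a"
    by metis
  \<comment> \<open>\<open>C\<close> is an arbitrary choice, but uniqueness fixes it on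
    \<open>S\<close>. Each law for \<open>f\<close> then follows by exhibiting one representation
    with coefficients in \<open>K\<close>.\<close>
  have C_eq: "C a k = c k" if "\<And>k. c k \<in> K" "(\<Sum>k\<in>S. c k * y $ k) = a" "k \<in> S" for a c k
    using coords_independent_coeffs_unique[OF K S(2), of "C a" c k] that CK C by simp
  define f where "f a = C a (Inl i)" for a
  have iS: "Inl i \<in> S" using S(1) i by auto
  have "f (a + b) = f a + f b" for a b
    unfolding f_def
    using K iS by (intro C_eq[of "\<lambda>k. C a k + C b k"])
      (auto simp: CK C distrib_right sum.distrib is_subfield_def)
  moreover have "f (c * a) = c * f a" if "c \<in> K" for c a
    unfolding f_def
    using K iS that by (intro C_eq[of "\<lambda>k. c * C a k"])
      (auto simp: CK C mult.assoc sum_distrib_left[symmetric] is_subfield_def)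
  moreover have "f (x $ k) = (if k = i then 1 else 0)" if "k \<in> I" for k
  proof -
    have "(\<Sum>l\<in>S. (if l = Inl k then 1 else 0) * y $ l) = (\<Sum>l\<in>S. if l = Inl k then y $ l else 0)"
      by (intro sum.cong) auto
    also have "\<dots> = x $ k" using S(1) that by (auto simp: y_def)
    finally show ?thesis
      using C_eq[of "\<lambda>l. if l = Inl k then 1 else 0" "x $ k" "Inl i"] K iS
      by (auto simp: f_def is_subfield_def)
  qed
  ultimately show ?thesis
    using CK unfolding linear_over_def f_def by (intro exI[of _ f]) (auto simp: f_def)
qed

text \<open>In \<open>x = (\<Sum>b\<in>B. u b *s b)\<close> the entries of each \<open>b\<close> are
  scalars from \<open>K\<close>, so \<open>f\<close> passes through them and only changes
  \<open>u b\<close> to \<open>f (u b)\<close>.\<close>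

lemma elementary_linear_subspace_map_closed:
  fixes x :: "'a::{field,finite} ^ 'n"
  assumes V: "elementary_linear_subspace K V" and x: "x \<in> V" and f: "linear_over K f"
  shows "(\<chi> j. f (x $ j)) \<in> V"
proof -
  obtain B where B: "B \<subseteq> {b. \<forall>i. b $ i \<in> K}" "vec.span B = V"
    using V unfolding elementary_linear_subspace_def by blast
  obtain u where u: "x = (\<Sum>b\<in>B. u b *s b)"
    using x B(2) by (auto simp: vec.span_finite)
  have "f (x $ j) = (\<Sum>b\<in>B. f (u b) *s b) $ j" for j
  proof -
    have "f (x $ j) = (\<Sum>b\<in>B. f (b $ j * u b))"
      unfolding u by (simp add: linear_over_sum[OF f] mult.commute)
    also have "\<dots> = (\<Sum>b\<in>B. b $ j * f (u b))"
      using f B(1) by (intro sum.cong) (auto simp: linear_over_def)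
    finally show ?thesis by (simp add: mult.commute)
  qed
  then have "(\<chi> j. f (x $ j)) = (\<Sum>b\<in>B. f (u b) *s b)"
    by (simp add: vec_eq_iff)
  also have "\<dots> \<in> V"
    unfolding B(2)[symmetric] by (intro vec.span_sum vec.span_scale vec.span_base)
  finally show ?thesis .
qed

lemma dual_family_independent:
  fixes b :: "'n \<Rightarrow> 'a::field ^ 'n"
  assumes "\<And>i k. i \<in> I \<Longrightarrow> k \<in> I \<Longrightarrow> b i $ k = (if k = i then 1 else 0)"
  shows "inj_on b I" "vec.independent (b ` I)"
proof -
  show inj: "inj_on b I"
    using assms by (metis inj_onI zero_neq_one)
  show "vec.independent (b ` I)"
  proof (rule vec.independent_if_scalars_zero)
    fix u v assume 0: "(\<Sum>v\<in>b ` I. u v *s v) = 0" and "v \<in> b ` I"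
    then obtain k where k: "k \<in> I" "v = b k" by blast
    have "0 = (\<Sum>i\<in>I. u (b i) *s b i) $ k"
      using 0 by (simp add: sum.reindex[OF inj])
    also have "\<dots> = (\<Sum>i\<in>I. if i = k then u (b i) else 0)"
      unfolding sum_component using assms k by (intro sum.cong) auto
    finally show "u v = 0" using k by simp
  qed simp
qed

lemma card_le_rank_over:
  assumes "coords_independent K x I"
  shows "card I \<le> rank_over K x"
  unfolding rank_over_def using assms by (intro Max_ge) auto

theorem lemma1:
  fixes q m r :: nat
    and K :: "'a::{field,finite} set"
    and x :: "'a ^ 'n"
  assumes "primepow q" and "m > 0"
    and "CARD('a) = q ^ m"
    and "is_subfield K" and "card K = q"
    and "rank_over K x = r"
  shows "\<exists>!V. V \<in> ELS K r \<and> x \<in> V"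
proof -
  note K = \<open>is_subfield K\<close>
  obtain I where I: "coords_independent K x I" "card I = r"
    using rank_over_attained[of K x] assms(6) by auto
  \<comment> \<open>An independent \<open>insert j I\<close> would have \<open>r + 1\<close>
    elements, exceeding the rank.\<close>
  have max: "\<not> coords_independent K x (insert j I)" if "j \<notin> I" for j
    using card_le_rank_over[of K x "insert j I"] that I(2) assms(6) by auto
  obtain f where f: "\<And>i. i \<in> I \<Longrightarrow> linear_over K (f i)" "\<And>i. i \<in> I \<Longrightarrow> range (f i) \<subseteq> K"
    "\<And>i k. i \<in> I \<Longrightarrow> k \<in> I \<Longrightarrow> f i (x $ k) = (if k = i then 1 else 0)"
    using dual_functional_exists[OF K I(1)] by metis
  define b where "b i = (\<chi> j. f i (x $ j))" for i
  have b: "inj_on b I" "vec.independent (b ` I)"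
    using dual_family_independent[of I b] f(3) by (auto simp: b_def)
  define W where "W = vec.span (b ` I)"
  have dimW: "vec.dim W = r"
    unfolding W_def using b I(2) by (simp add: vec.dim_eq_card_independent card_image)
  have "x $ j = (\<Sum>i\<in>I. x $ i *s b i) $ j" for j
  proof -
    obtain c where c: "\<And>i. c i \<in> K" "x $ j = (\<Sum>k\<in>I. c k * x $ k)"
      using maximal_coords_independent_spans[OF K I(1) max] by blast
    \<comment> \<open>Duality makes \<open>f i\<close> read off the \<open>i\<close>-th coefficient
      of \<open>x $ j\<close>, so \<open>b i $ j\<close> is that coefficient.\<close>
    have "f i (x $ j) = c i" if "i \<in> I" for i
    proof -
      have "f i (x $ j) = (\<Sum>k\<in>I. f i (c k * x $ k))"
        unfolding c(2) by (rule linear_over_sum[OF f(1)[OF that]])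
      also have "\<dots> = (\<Sum>k\<in>I. if k = i then c k else 0)"
        using f(1,3) that c(1) by (intro sum.cong) (auto simp: linear_over_def)
      finally show ?thesis using that by simp
    qed
    then show ?thesis using c(2) by (simp add: b_def mult.commute)
  qed
  then have "x = (\<Sum>i\<in>I. x $ i *s b i)"
    by (intro vec_eq_iff[THEN iffD2] allI)
  then have xW: "x \<in> W"
    unfolding W_def by (metis (no_types, lifting) imageI vec.span_base vec.span_scale vec.span_sum)
  have "b ` I \<subseteq> {v. \<forall>j. v $ j \<in> K}"
    using f(2) by (fastforce simp: b_def)
  then have W: "W \<in> ELS K r"
    using b(2) dimW unfolding ELS_def elementary_linear_subspace_def W_def by blast
  have "V = W" if V: "V \<in> ELS K r" "x \<in> V" for V
  proof -
    \<comment> \<open>Each \<open>b i\<close> is the image of \<open>x\<close> under the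
      coordinatewise map \<open>f i\<close>, which preserves \<open>V\<close>.\<close>
    have "b ` I \<subseteq> V"
      using V elementary_linear_subspace_map_closed f(1) unfolding ELS_def b_def by blast
    moreover have "vec.subspace V" "vec.dim V = r"
      using V(1) by (auto simp: ELS_def elementary_linear_subspace_def)
    ultimately have "W \<subseteq> V"
      unfolding W_def by (intro vec.span_minimal)
    then show ?thesis
      using vec.subspace_dim_equal[of W V] \<open>vec.subspace V\<close> \<open>vec.dim V = r\<close> dimW
      by (simp add: W_def)
  qed
  with W xW show ?thesis by blast
qed

end
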